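(* Let $f:\mathbb R^2\to\mathbb R^2$ be the Guarino-Guihéneuf-Santiago diffeomorphism and $S_{n_0}$ the associated rectangle, as specified in the context. Then every point $z\in S_{n_0}$ is Lyapunov irregular for every non-zero vector, that is, for every $z\in S_{n_0}$ and every $v\in\mathbb R^2\setminus\{0\}$ the limit $\lim_{n\to\infty}\frac1n\log\|Df^n(z)v\|$ does not exist.
   Context: Fix $\sigma>1$ and numbers $a,b$ with $1<a<b<\sigma$. Let $I=[a,b]$, let $H(x,y)=(\sigma^{-2}x,\sigma y)$ on $\mathbb R^2$, and let $R(x,y)=(a+b-y,x)$. For $n\in\mathbb N$ let $S_n=I\times\sigma^{-n}I$ and $U_n=\sigma^{-n}I\times I$ (so $H^n(S_n)=U_{2n}$). The Guarino-Guihéneuf-Santiago diffeomorphism (its existence is known) is a $\mathcal C^\infty$-diffeomorphism $f:\mathbb R^2\to\mathbb R^2$, equal to the identity outside some ball centered at the origin, which has a saddle fixed point $O=(0,0)$ with a saddle connection (a separatrix of the stable manifold of $O$ coincides with a separatrix of the unstable manifold of $O$, so that it bounds an open 2-disk), together with positive integers $n_0,k_0$ such that: (a) there is a neighborhood $\mathcal V$ of $O$ such that $\bigcup_{n\ge n_0}\bigcup_{0\le\ell\le n}f^\ell(S_n)\subset\mathcal V$ and $f|_{\mathcal V}=H|_{\mathcal V}$; (b) $f^{k_0}(U_n)=S_n$ for all $n\ge n_0$, and $f^{k_0}(x,y)=R(x,y)$ for all $(x,y)\in[0,\sigma^{-2n_0}]\times I$. In particular, for every $n\ge n_0$, $f^{n+k_0}(x,y)=(a+b-\sigma^ny,\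 \sigma^{-2n}x)\in S_{2n}$ for all $(x,y)\in S_n$. *)

theory Defs
  imports "HOL-Analysis.Analysis"
begin

section \<open>Smooth maps and diffeomorphisms\<close>

text \<open>\<open>Ck k f\<close>: the map \<open>f\<close> is of class \<open>C\<^sup>k\<close> on the whole space. The recursion goes
  through the directional derivatives \<open>x \<mapsto> Df(x)v\<close>; in finite dimension this is the usual notion.\<close>

primrec Ck :: "nat \<Rightarrow> ('a::real_normed_vector \<Rightarrow> 'b::real_normed_vector) \<Rightarrow> bool" where
  "Ck 0 f \<longleftrightarrow> continuous_on UNIV f"
| "Ck (Suc k) f \<longleftrightarrow> (\<forall>x. f differentiable (at x)) \<and>
     (\<forall>v. Ck k (\<lambda>x. frechet_derivative f (at x) v))"

definition smooth :: "('a::real_normed_vector \<Rightarrow> 'b::real_normed_vector) \<Rightarrow> bool" where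
  "smooth f \<longleftrightarrow> (\<forall>k. Ck k f)"

definition smooth_diffeo :: "('a::real_normed_vector \<Rightarrow> 'a) \<Rightarrow> bool" where
  "smooth_diffeo f \<longleftrightarrow> bij f \<and> smooth f \<and> smooth (inv f)"

section \<open>Planar saddles and saddle connections\<close>

definition saddle_fixed_point :: "(real \<times> real \<Rightarrow> real \<times> real) \<Rightarrow> real \<times> real \<Rightarrow> bool" where
  "saddle_fixed_point f p \<longleftrightarrow> f p = p \<and>
     (\<exists>l m u w. u \<noteq> 0 \<and> frechet_derivative f (at p) u = l *\<^sub>R u \<and> \<bar>l\<bar> < 1 \<and>
                w \<noteq> 0 \<and> frechet_derivative f (at p) w = m *\<^sub>R w \<and> 1 < \<bar>m\<bar>)"

definition stable_manifold :: "(real \<times> real \<Rightarrow> real \<times> real) \<Rightarrow> real \<times> real \<Rightarrow> (real \<times> real) set" where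
  "stable_manifold f p = {x. (\<lambda>n. (f ^^ n) x) \<longlonglongrightarrow> p}"

text \<open>The stable manifold of a planar saddle \<open>p\<close> is an injectively immersed smooth curve, tangent at
  \<open>p\<close> to the contracted eigendirection. A separatrix is a connected component of the stable manifold
  minus \<open>p\<close> in the topology of the immersed curve (not in the subspace topology of the plane, in which
  one branch may accumulate on the other). Replacing \<open>\<gamma>\<close> by \<open>t \<mapsto> \<gamma>(-t)\<close> gives the other separatrix.\<close>

definition stable_separatrix ::
    "(real \<times> real \<Rightarrow> real \<times> real) \<Rightarrow> real \<times> real \<Rightarrow> (real \<times> real) set \<Rightarrow> bool" where
  "stable_separatrix f p \<Gamma> \<longleftrightarrow>
     (\<exists>\<gamma> :: real \<Rightarrow> real \<times> real.
        smooth \<gamma> \<and> inj \<gamma> \<and> (\<forall>t. vector_derivative \<gamma> (at t) \<noteq> 0) \<and>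
        \<gamma> 0 = p \<and> range \<gamma> = stable_manifold f p \<and>
        (\<exists>l. \<bar>l\<bar> < 1 \<and>
           frechet_derivative f (at p) (vector_derivative \<gamma> (at 0))
             = l *\<^sub>R vector_derivative \<gamma> (at 0)) \<and>
        \<Gamma> = \<gamma> ` {0<..})"

definition unstable_separatrix ::
    "(real \<times> real \<Rightarrow> real \<times> real) \<Rightarrow> real \<times> real \<Rightarrow> (real \<times> real) set \<Rightarrow> bool" where
  "unstable_separatrix f p \<Gamma> \<longleftrightarrow> stable_separatrix (inv f) p \<Gamma>"

definition has_saddle_connection :: "(real \<times> real \<Rightarrow> real \<times> real) \<Rightarrow> real \<times> real \<Rightarrow> bool" where
  "has_saddle_connection f p \<longleftrightarrow>
     (\<exists>\<Gamma>. stable_separatrix f p \<Gamma> \<and> unstable_separatrix f p \<Gamma> \<and>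
        (\<exists>D. open D \<and> D homeomorphic (ball 0 1 :: (real \<times> real) set) \<and> frontier D = insert p \<Gamma>))"

section \<open>The Guarino--Guiheneuf--Santiago diffeomorphism\<close>

definition H :: "real \<Rightarrow> real \<times> real \<Rightarrow> real \<times> real" where
  "H \<sigma> = (\<lambda>(x, y). (x / \<sigma>^2, \<sigma> * y))"

definition R :: "real \<Rightarrow> real \<Rightarrow> real \<times> real \<Rightarrow> real \<times> real" where
  "R a b = (\<lambda>(x, y). (a + b - y, x))"

definition S :: "real \<Rightarrow> real \<Rightarrow> real \<Rightarrow> nat \<Rightarrow> (real \<times> real) set" where
  "S \<sigma> a b n = {a..b} \<times> (\<lambda>y. y / \<sigma>^n) ` {a..b}"

definition U :: "real \<Rightarrow> real \<Rightarrow> real \<Rightarrow> nat \<Rightarrow> (real \<times> real) set" where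
  "U \<sigma> a b n = (\<lambda>x. x / \<sigma>^n) ` {a..b} \<times> {a..b}"

definition GGS_diffeo ::
    "real \<Rightarrow> real \<Rightarrow> real \<Rightarrow> nat \<Rightarrow> nat \<Rightarrow> (real \<times> real \<Rightarrow> real \<times> real) \<Rightarrow> bool" where
  "GGS_diffeo \<sigma> a b n\<^sub>0 k\<^sub>0 f \<longleftrightarrow>
     smooth_diffeo f \<and>
     (\<exists>r>0. \<forall>z. z \<notin> ball 0 r \<longrightarrow> f z = z) \<and>
     saddle_fixed_point f 0 \<and> has_saddle_connection f 0 \<and>
     0 < n\<^sub>0 \<and> 0 < k\<^sub>0 \<and>
     (\<exists>V. 0 \<in> interior V \<and>
        (\<Union>n\<in>{n\<^sub>0..}. \<Union>l\<in>{0..n}. (f ^^ l) ` S \<sigma> a b n) \<subseteq> V \<and>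
        (\<forall>z\<in>V. f z = H \<sigma> z)) \<and>
     (\<forall>n\<ge>n\<^sub>0. (f ^^ k\<^sub>0) ` U \<sigma> a b n = S \<sigma> a b n) \<and>
     (\<forall>z \<in> {0..1 / \<sigma>^(2 * n\<^sub>0)} \<times> {a..b}. (f ^^ k\<^sub>0) z = R a b z)"

section \<open>Lyapunov irregularity\<close>

definition lyapunov_irregular ::
    "(real \<times> real \<Rightarrow> real \<times> real) \<Rightarrow> real \<times> real \<Rightarrow> real \<times> real \<Rightarrow> bool" where
  "lyapunov_irregular f z v \<longleftrightarrow>
     \<not> convergent (\<lambda>n. 1 / real n * ln (norm (frechet_derivative (f ^^ n) (at z) v)))"

end

theory Submission
  imports Defs
begin

text \<open>One return \<open>S\<^sub>n \<rightarrow> S\<^sub>2\<^sub>n\<close> acts on vectors by \<open>(v\<^sub>1, v\<^sub>2) \<mapsto> (-\<sigma>\<^sup>n v\<^sub>2, \<sigma>\<^sup>-\<^sup>2\<^sup>n v\<^sub>1)\<close>, hence two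
  consecutive returns act by \<open>-diag (1, \<sigma>\<^sup>-\<^sup>3\<^sup>n)\<close>. After \<open>2i\<close> returns from \<open>S\<^sub>m\<close>, at time \<open>N + O(i)\<close> with
  \<open>N = m 4\<^sup>i\<close>, the vector is \<open>\<plusminus>(v\<^sub>1, \<sigma>\<^sup>m\<^sup>-\<^sup>N v\<^sub>2)\<close>, with exponent \<open>0\<close> or \<open>-ln \<sigma>\<close>. After a further
  \<open>N/4\<close> steps of \<open>H\<close> it is \<open>\<plusminus>(\<sigma>\<^sup>-\<^sup>N\<^sup>/\<^sup>2 v\<^sub>1, \<sigma>\<^sup>m\<^sup>-\<^sup>3\<^sup>N\<^sup>/\<^sup>4 v\<^sub>2)\<close>, with exponent \<open>-(2/5) ln \<sigma>\<close>,
  respectively \<open>-(3/5) ln \<sigma>\<close>. The first return from \<open>S\<^sub>n\<^sub>0\<close> needs separate treatment: \<open>U\<^sub>2\<^sub>n\<^sub>0\<close> is disjoint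
  from the strip on which \<open>f\<^sup>k\<^sup>0\<close> is known to be the rotation, so there only the invertibility
  of the derivative is used.\<close>

section \<open>Derivatives of iterates\<close>

lemma smooth_imp_differentiable: "smooth f \<Longrightarrow> f differentiable (at x)"
  unfolding smooth_def by (metis Ck.simps(2))

lemma differentiable_funpow:
  fixes f :: "'a::real_normed_vector \<Rightarrow> 'a"
  assumes "\<And>x. f differentiable (at x)"
  shows "(f ^^ n) differentiable (at x)"
proof (induction n arbitrary: x)
  case 0
  show ?case unfolding funpow.simps(1) id_def by simp
next
  case (Suc n)
  then show ?case unfolding funpow.simps(2) by (intro differentiable_chain_at assms)
qed

lemma frechet_derivative_funpow_add:
  assumes "\<And>x. f differentiable (at x)"
  shows "frechet_derivative (f ^^ (n + p)) (at x) v =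
    frechet_derivative (f ^^ n) (at ((f ^^ p) x)) (frechet_derivative (f ^^ p) (at x) v)"
  by (simp add: funpow_add frechet_derivative_compose differentiable_funpow assms)

text \<open>By the chain rule, the derivative of \<open>g ^^ n\<close> at the image point is a left
  inverse of the derivative of \<open>f ^^ n\<close>, which is therefore injective.\<close>

lemma frechet_derivative_funpow_nonzero:
  fixes f g :: "'a::real_normed_vector \<Rightarrow> 'a"
  assumes "\<And>x. f differentiable (at x)" "\<And>x. g differentiable (at x)" "\<And>x. g (f x) = x" "v \<noteq> 0"
  shows "frechet_derivative (f ^^ n) (at x) v \<noteq> 0"
proof
  assume 0: "frechet_derivative (f ^^ n) (at x) v = 0"
  have "(g ^^ n) \<circ> (f ^^ n) = id"
  proof (induction n)
    case (Suc n)
    have "(g ^^ Suc n) \<circ> (f ^^ Suc n) = (g ^^ n) \<circ> (g \<circ> f) \<circ> (f ^^ n)"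
      by (simp add: funpow_swap1 fun_eq_iff)
    also have "g \<circ> f = id" using assms(3) by auto
    finally show ?case using Suc by simp
  qed simp
  moreover have "frechet_derivative ((g ^^ n) \<circ> (f ^^ n)) (at x) v =
      frechet_derivative (g ^^ n) (at ((f ^^ n) x)) (frechet_derivative (f ^^ n) (at x) v)"
    by (simp add: frechet_derivative_compose differentiable_funpow assms)
  moreover have "linear (frechet_derivative (g ^^ n) (at ((f ^^ n) x)))"
    by (intro linear_frechet_derivative differentiable_funpow assms)
  ultimately have "frechet_derivative id (at x) v = 0"
    using 0 by (simp add: linear_0)
  then show False using assms(4) by (simp add: id_def)
qed

text \<open>On the boundary of the box the derivative is still determined by the values on the box,
  because these determine all one-sided directional derivatives along the coordinate axes.\<close>
lemma frechet_derivative_eq_on_cbox: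
  fixes f g :: "'a::euclidean_space \<Rightarrow> 'b::real_normed_vector"
  assumes "f differentiable (at x)" "(g has_derivative g') (at x)"
    and "x \<in> cbox l u" "\<And>i. i \<in> Basis \<Longrightarrow> l \<bullet> i < u \<bullet> i"
    and "\<And>y. y \<in> cbox l u \<Longrightarrow> f y = g y"
  shows "frechet_derivative f (at x) = g'"
proof (rule frechet_derivative_unique_within_closed_interval[of l u x f])
  show "(f has_derivative frechet_derivative f (at x)) (at x within cbox l u)"
    using assms(1) frechet_derivative_works has_derivative_at_withinI by blast
  show "(f has_derivative g') (at x within cbox l u)"
    using has_derivative_transform[OF assms(3) assms(5) has_derivative_at_withinI[OF assms(2)]] .
qed (use assms in auto)

text \<open>Skipping the first \<open>p\<close> steps of an orbit only changes the weight
  \<open>1 / (n + p)\<close> into \<open>1 / n\<close>, and the quotient of the two weights tends to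
  1. So irregularity may be checked at a later point of the orbit.\<close>

lemma lyapunov_irregular_shift:
  assumes "\<And>x. f differentiable (at x)"
    and "lyapunov_irregular f ((f ^^ p) z) (frechet_derivative (f ^^ p) (at z) v)"
  shows "lyapunov_irregular f z v"
proof (rule ccontr)
  let ?u = "\<lambda>n. ln (norm (frechet_derivative (f ^^ n) (at z) v))"
  let ?w = "\<lambda>n. ln (norm (frechet_derivative (f ^^ n) (at ((f ^^ p) z)) (frechet_derivative (f ^^ p) (at z) v)))"
  assume "\<not> ?thesis"
  then obtain L where "(\<lambda>n. 1 / real n * ?u n) \<longlonglongrightarrow> L"
    unfolding lyapunov_irregular_def convergent_def by auto
  then have "(\<lambda>n. 1 / real (n + p) * ?u (n + p)) \<longlonglongrightarrow> L"
    by (rule LIMSEQ_ignore_initial_segment)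
  then have 1: "(\<lambda>n. 1 / real (n + p) * ?w n) \<longlonglongrightarrow> L"
    by (simp only: frechet_derivative_funpow_add[OF assms(1)])
  have "(\<lambda>n. 1 + real p * (1 / real n)) \<longlonglongrightarrow> 1 + real p * 0"
    by (intro tendsto_intros lim_1_over_n)
  from tendsto_mult[OF this 1] have 2: "(\<lambda>n. (1 + real p * (1 / real n)) * (1 / real (n + p) * ?w n)) \<longlonglongrightarrow> 1 * L"
    by (simp only: mult_zero_right add_0_right)
  have "\<forall>\<^sub>F n in sequentially. (1 + real p * (1 / real n)) * (1 / real (n + p) * ?w n) = 1 / real n * ?w n"
    using eventually_gt_at_top[of 0]
  proof eventually_elim
    case (elim n)
    then have "1 + real p * (1 / real n) = real (n + p) / real n"
      by (simp add: field_simps)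
    with elim show ?case by simp
  qed
  then have "(\<lambda>n. 1 / real n * ?w n) \<longlonglongrightarrow> L"
    using Lim_transform_eventually[OF 2] by simp
  then show False
    using assms(2) unfolding lyapunov_irregular_def convergent_def by blast
qed

section \<open>Returns to the rectangles\<close>

text \<open>In the form of a closed box, the values of a map on the rectangle determine its
  derivative at all points of the rectangle, corners included.\<close>

lemma S_eq_cbox: "1 < \<sigma> \<Longrightarrow> S \<sigma> a b n = cbox (a, a / \<sigma>^n) (b, b / \<sigma>^n)"
  unfolding S_def cbox_Pair_eq box_real
  by (subst image_divide_atLeastAtMost) auto

lemma mem_S_iff:
  "1 < \<sigma> \<Longrightarrow> (x, y) \<in> S \<sigma> a b n \<longleftrightarrow> a \<le> x \<and> x \<le> b \<and> a \<le> \<sigma>^n * y \<and> \<sigma>^n * y \<le> b"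
  by (auto simp: S_eq_cbox cbox_Pair_eq field_simps)

locale ggs =
  fixes \<sigma> a b :: real and n\<^sub>0 k\<^sub>0 :: nat and f :: "real \<times> real \<Rightarrow> real \<times> real"
  assumes sigma: "1 < \<sigma>" and a_gt_1: "1 < a" and a_less_b: "a < b" and b_less: "b < \<sigma>"
    and ggs: "GGS_diffeo \<sigma> a b n\<^sub>0 k\<^sub>0 f"
begin

abbreviation D :: "nat \<Rightarrow> real \<times> real \<Rightarrow> real \<times> real \<Rightarrow> real \<times> real" where
  "D n z \<equiv> frechet_derivative (f ^^ n) (at z)"

lemma diffeo: "smooth_diffeo f"
  using ggs unfolding GGS_diffeo_def by (rule conjunct1)

lemma differentiable: "f differentiable (at z)"
  using diffeo by (simp add: smooth_imp_differentiable smooth_diffeo_def)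

lemmas D_add = frechet_derivative_funpow_add[of f, OF differentiable]

lemma D_scaleR: "D n z (c *\<^sub>R v) = c *\<^sub>R D n z v"
  by (simp add: linear_cmul linear_frechet_derivative differentiable_funpow differentiable)

lemma D_nonzero: "v \<noteq> 0 \<Longrightarrow> D n z v \<noteq> 0"
proof (rule frechet_derivative_funpow_nonzero[of f "inv f"])
  have "bij f" "smooth (inv f)"
    using diffeo unfolding smooth_diffeo_def by auto
  then show "inv f differentiable (at x)" "inv f (f x) = x" for x
    by (auto simp: smooth_imp_differentiable bij_is_inj)
qed (use differentiable in auto)

lemma n0_pos: "0 < n\<^sub>0"
  using ggs unfolding GGS_diffeo_def by blast

text \<open>The first \<open>n\<close> iterates keep the rectangle inside \<open>V\<close>, where
  \<open>f\<close> is the diagonal map \<open>H\<close>.\<close>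

lemma funpow_S:
  assumes "n\<^sub>0 \<le> n" "z \<in> S \<sigma> a b n" "l \<le> n"
  shows "(f ^^ l) z = (fst z / \<sigma>^(2 * l), \<sigma>^l * snd z)"
proof -
  obtain V where V: "(\<Union>n\<in>{n\<^sub>0..}. \<Union>l\<in>{0..n}. (f ^^ l) ` S \<sigma> a b n) \<subseteq> V" "\<forall>z\<in>V. f z = H \<sigma> z"
    using ggs unfolding GGS_diffeo_def by blast
  show ?thesis
    using assms(3)
  proof (induction l)
    case (Suc l)
    have "(f ^^ l) z \<in> V"
      using V(1) assms Suc.prems by fastforce
    then show ?case
      using V(2) Suc by (simp add: H_def power2_eq_square field_simps)
  qed simp
qed

lemma D_S:
  assumes "n\<^sub>0 \<le> n" "z \<in> S \<sigma> a b n" "l \<le> n"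
  shows "D l z v = (fst v / \<sigma>^(2 * l), \<sigma>^l * snd v)"
proof -
  have "D l z = (\<lambda>v. (fst v / \<sigma>^(2 * l), \<sigma>^l * snd v))"
  proof (rule frechet_derivative_eq_on_cbox)
    show "((\<lambda>z. (fst z / \<sigma>^(2 * l), \<sigma>^l * snd z)) has_derivative
            (\<lambda>v. (fst v / \<sigma>^(2 * l), \<sigma>^l * snd v))) (at z)"
      using sigma by (auto intro!: derivative_eq_intros)
    show "z \<in> cbox (a, a / \<sigma>^n) (b, b / \<sigma>^n)"
      using assms S_eq_cbox[OF sigma] by simp
    show "(a, a / \<sigma>^n) \<bullet> i < (b, b / \<sigma>^n) \<bullet> i" if "i \<in> Basis" for i
      using that a_less_b sigma by (auto simp: Basis_prod_def divide_strict_right_mono)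
    show "(f ^^ l) y = (fst y / \<sigma>^(2 * l), \<sigma>^l * snd y)" if "y \<in> cbox (a, a / \<sigma>^n) (b, b / \<sigma>^n)" for y
      using that assms S_eq_cbox[OF sigma] funpow_S by simp
  qed (simp add: differentiable_funpow differentiable)
  then show ?thesis by simp
qed

lemma funpow_strip:
  "z \<in> {0..1 / \<sigma>^(2 * n\<^sub>0)} \<times> {a..b} \<Longrightarrow> (f ^^ k\<^sub>0) z = (a + b - snd z, fst z)"
  using ggs unfolding GGS_diffeo_def R_def by (auto simp: split_beta)

lemma D_strip:
  assumes "z \<in> {0..1 / \<sigma>^(2 * n\<^sub>0)} \<times> {a..b}"
  shows "D k\<^sub>0 z v = (- snd v, fst v)"
proof -
  have box: "cbox (0, a) (1 / \<sigma>^(2 * n\<^sub>0), b) = {0..1 / \<sigma>^(2 * n\<^sub>0)} \<times> {a..b}"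
    by (simp add: cbox_Pair_eq)
  have "D k\<^sub>0 z = (\<lambda>v. (- snd v, fst v))"
  proof (rule frechet_derivative_eq_on_cbox)
    show "((\<lambda>z. (a + b - snd z, fst z)) has_derivative (\<lambda>v. (- snd v, fst v))) (at z)"
      by (auto intro!: derivative_eq_intros)
    show "(0, a) \<bullet> i < (1 / \<sigma>^(2 * n\<^sub>0), b) \<bullet> i" if "i \<in> Basis" for i
      using that a_less_b sigma by (auto simp: Basis_prod_def)
    show "z \<in> cbox (0, a) (1 / \<sigma>^(2 * n\<^sub>0), b)"
      using assms box by simp
    show "(f ^^ k\<^sub>0) y = (a + b - snd y, fst y)" if "y \<in> cbox (0, a) (1 / \<sigma>^(2 * n\<^sub>0), b)" for y
      using that box funpow_strip by simp
  qed (simp add: differentiable_funpow differentiable)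
  then show ?thesis by simp
qed

text \<open>\<open>H\<close> takes the rectangle into \<open>U\<close> at level
  \<open>2 * n\<^sub>0\<close>, where first coordinates are at least
  \<open>a / \<sigma>^(2 * n\<^sub>0)\<close>, beyond the strip because \<open>1 < a\<close>. Hence
  the argument goes through the equality of image sets instead of the rotation formula.\<close>

lemma first_return:
  assumes "z \<in> S \<sigma> a b n\<^sub>0"
  shows "(f ^^ (k\<^sub>0 + n\<^sub>0)) z \<in> S \<sigma> a b (2 * n\<^sub>0)"
proof -
  have "(f ^^ n\<^sub>0) z = (fst z / \<sigma>^(2 * n\<^sub>0), \<sigma>^n\<^sub>0 * snd z)"
    using funpow_S assms by blast
  then have "(f ^^ n\<^sub>0) z \<in> U \<sigma> a b (2 * n\<^sub>0)"
    using assms sigma by (auto simp: S_def U_def simp del: image_divide_atLeastAtMost)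
  moreover have "(f ^^ k\<^sub>0) ` U \<sigma> a b (2 * n\<^sub>0) = S \<sigma> a b (2 * n\<^sub>0)"
    using ggs unfolding GGS_diffeo_def by simp
  ultimately show ?thesis
    by (auto simp: funpow_add)
qed

lemma one_return:
  assumes "n\<^sub>0 < n" "z \<in> S \<sigma> a b n"
  shows "(f ^^ (k\<^sub>0 + n)) z \<in> S \<sigma> a b (2 * n)"
    and "D (k\<^sub>0 + n) z v = (- (\<sigma>^n * snd v), fst v / \<sigma>^(2 * n))"
proof -
  obtain x y where z: "z = (x, y)" by force
  have xy: "a \<le> x" "x \<le> b" "a \<le> \<sigma>^n * y" "\<sigma>^n * y \<le> b"
    using assms(2) mem_S_iff[OF sigma] z by auto
  have fn: "(f ^^ n) z = (x / \<sigma>^(2 * n), \<sigma>^n * y)"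
    using funpow_S[of n z n] assms z by simp
  \<comment> \<open>Bounding \<open>x\<close> by \<open>\<sigma>\<close> costs one factor
    \<open>\<sigma>\<close>, which \<open>n\<^sub>0 < n\<close> pays for:
    \<open>2 * n\<^sub>0 + 1 \<le> 2 * n\<close>. So the point enters the strip of the
    rotation.\<close>
  have "x * \<sigma>^(2 * n\<^sub>0) \<le> \<sigma> * \<sigma>^(2 * n\<^sub>0)"
    using xy b_less sigma by (intro mult_right_mono) auto
  also have "\<dots> = \<sigma>^(Suc (2 * n\<^sub>0))" by simp
  also have "\<dots> \<le> \<sigma>^(2 * n)"
    using assms(1) sigma by (intro power_increasing) auto
  finally have "x / \<sigma>^(2 * n) \<le> 1 / \<sigma>^(2 * n\<^sub>0)"
    using sigma by (simp add: field_simps)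
  then have strip: "(f ^^ n) z \<in> {0..1 / \<sigma>^(2 * n\<^sub>0)} \<times> {a..b}"
    using fn xy a_gt_1 sigma by simp
  have "(f ^^ (k\<^sub>0 + n)) z = (a + b - \<sigma>^n * y, x / \<sigma>^(2 * n))"
    using funpow_strip[OF strip] fn by (simp add: funpow_add)
  then show "(f ^^ (k\<^sub>0 + n)) z \<in> S \<sigma> a b (2 * n)"
    using xy sigma by (simp add: mem_S_iff)
  show "D (k\<^sub>0 + n) z v = (- (\<sigma>^n * snd v), fst v / \<sigma>^(2 * n))"
    using D_strip[OF strip] D_S[OF _ assms(2)] assms(1) by (simp add: D_add)
qed

text \<open>The rotation swaps the axes between the returns. The first component is contracted by
  \<open>\<sigma>^(2 * n)\<close> and then expanded by the same factor; the second is expanded by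
  \<open>\<sigma>^n\<close> and then contracted by \<open>\<sigma>^(4 * n)\<close>.\<close>

lemma two_returns:
  assumes "n\<^sub>0 < n" "z \<in> S \<sigma> a b n"
  shows "(f ^^ (3 * n + 2 * k\<^sub>0)) z \<in> S \<sigma> a b (4 * n)"
    and "D (3 * n + 2 * k\<^sub>0) z v = - (fst v, snd v / \<sigma>^(3 * n))"
proof -
  let ?w = "(f ^^ (k\<^sub>0 + n)) z"
  have w: "?w \<in> S \<sigma> a b (2 * n)" using one_return(1)[OF assms] .
  have n: "n\<^sub>0 < 2 * n" using assms(1) by simp
  have t: "3 * n + 2 * k\<^sub>0 = (k\<^sub>0 + 2 * n) + (k\<^sub>0 + n)" by simp
  show "(f ^^ (3 * n + 2 * k\<^sub>0)) z \<in> S \<sigma> a b (4 * n)"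
    using one_return(1)[OF n w] unfolding t funpow_add[of "k\<^sub>0 + 2 * n"] by simp
  show "D (3 * n + 2 * k\<^sub>0) z v = - (fst v, snd v / \<sigma>^(3 * n))"
    unfolding t D_add[of "k\<^sub>0 + 2 * n"] one_return(2)[OF assms] one_return(2)[OF n w]
    using sigma by (simp add: field_simps flip: power_add)
qed

text \<open>Total duration of \<open>2 * i\<close> returns from level \<open>m\<close>; the summand
  is the length of the pair of returns that starts at level \<open>m * 4^j\<close>.\<close>

definition return_time :: "nat \<Rightarrow> nat \<Rightarrow> nat" where
  "return_time m i = (\<Sum>j<i. 3 * (m * 4^j) + 2 * k\<^sub>0)"

lemma return_time_eq: "real (return_time m i) = real m * 4^i - real m + 2 * real k\<^sub>0 * real i"
  by (induction i) (simp_all add: return_time_def algebra_simps)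

text \<open>The exponents \<open>3 * (m * 4^j)\<close> for \<open>j < i\<close> sum to
  \<open>m * 4^i - m\<close>, whence the factor \<open>\<sigma>^m / \<sigma>^(m * 4^i)\<close>; each
  pair of returns contributes one sign.\<close>

lemma even_returns:
  assumes "n\<^sub>0 < m" "z \<in> S \<sigma> a b m"
  shows "(f ^^ return_time m i) z \<in> S \<sigma> a b (m * 4^i)
    \<and> D (return_time m i) z v = (-1)^i *\<^sub>R (fst v, snd v * \<sigma>^m / \<sigma>^(m * 4^i))"
proof (induction i)
  case 0
  then show ?case using assms sigma by (simp add: return_time_def id_def)
next
  case (Suc i)
  let ?n = "m * 4^i" let ?w = "(f ^^ return_time m i) z"
  have n: "n\<^sub>0 < ?n"
    using assms(1) by (metis less_le_trans mult.right_neutral mult_le_mono2 one_le_power one_le_numeral)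
  have t: "return_time m (Suc i) = (3 * ?n + 2 * k\<^sub>0) + return_time m i"
    by (simp add: return_time_def)
  have "(f ^^ return_time m (Suc i)) z = (f ^^ (3 * ?n + 2 * k\<^sub>0)) ?w"
    unfolding t funpow_add[of "3 * ?n + 2 * k\<^sub>0"] by simp
  moreover have "D (return_time m (Suc i)) z v =
      (-1)^i *\<^sub>R (- (fst v, snd v * \<sigma>^m / \<sigma>^?n / \<sigma>^(3 * ?n)))"
    unfolding t D_add[of "3 * ?n + 2 * k\<^sub>0"] Suc[THEN conjunct2] D_scaleR
      two_returns(2)[OF n Suc[THEN conjunct1]] by simp
  moreover have "\<sigma>^?n * \<sigma>^(3 * ?n) = \<sigma>^(m * 4^Suc i)"
    by (simp add: mult.left_commute flip: power_add)
  ultimately show ?case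
    using Suc two_returns(1)[OF n, of ?w] by (simp add: mult.commute mult.left_commute)
qed

lemma norm_D_return_time:
  assumes "n\<^sub>0 < m" "z \<in> S \<sigma> a b m"
  shows "norm (D (return_time m i) z v) = norm (fst v, snd v * \<sigma>^m / \<sigma>^(m * 4^i))"
  unfolding even_returns[OF assms, THEN conjunct2] norm_scaleR by simp

text \<open>Put \<open>q = m * 4^i\<close>. At level \<open>4 * q\<close>, the next \<open>q\<close>
  steps are linear and raise the second factor from \<open>\<sigma>^m / \<sigma>^(4 * q)\<close> to
  \<open>\<sigma>^m / \<sigma>^(3 * q)\<close>. With the contraction of the first component pulled
  out, the vector is, up to sign, the one found after \<open>2 * i\<close> returns, so one
  asymptotic estimate serves both sequences of times.\<close>

lemma norm_D_after_return_time:
  assumes "n\<^sub>0 < m" "z \<in> S \<sigma> a b m"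
  shows "norm (D (m * 4^i + return_time m (Suc i)) z v) =
    norm (fst v, snd v * \<sigma>^m / \<sigma>^(m * 4^i)) / \<sigma>^(2 * (m * 4^i))"
proof -
  let ?q = "m * 4^i"
  have n: "n\<^sub>0 \<le> m * 4^Suc i" "?q \<le> m * 4^Suc i"
    using assms(1) by (auto intro: order_trans[of _ m])
  have "D (?q + return_time m (Suc i)) z v =
      (-1)^Suc i *\<^sub>R (fst v / \<sigma>^(2 * ?q), \<sigma>^?q * (snd v * \<sigma>^m / \<sigma>^(m * 4^Suc i)))"
    unfolding D_add even_returns[OF assms, THEN conjunct2] D_scaleR
      D_S[OF n(1) even_returns[OF assms, THEN conjunct1] n(2)] by simp
  also have "\<sigma>^(m * 4^Suc i) = \<sigma>^?q * \<sigma>^?q * \<sigma>^(2 * ?q)"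
    by (simp add: mult.left_commute flip: power_add)
  also have "(fst v / \<sigma>^(2 * ?q), \<sigma>^?q * (snd v * \<sigma>^m / (\<sigma>^?q * \<sigma>^?q * \<sigma>^(2 * ?q)))) =
      (1 / \<sigma>^(2 * ?q)) *\<^sub>R (fst v, snd v * \<sigma>^m / \<sigma>^?q)"
    using sigma by simp
  finally show ?thesis
    using sigma by (simp del: scaleR_Pair)
qed

section \<open>The exponents along the two sequences of times\<close>

text \<open>If \<open>fst v\<close> is nonzero, the norm tends to its absolute value and the
  logarithm stays bounded; otherwise the logarithm is affine in \<open>r i\<close> with slope
  \<open>- ln \<sigma>\<close>.\<close>

lemma ln_norm_growth:
  assumes "v \<noteq> 0" "filterlim r at_top sequentially"
  shows "(\<lambda>i. ln (norm (fst v, snd v * \<sigma>^m / \<sigma>^r i)) / real (r i))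
    \<longlonglongrightarrow> (if fst v = 0 then - ln \<sigma> else 0)"
proof (cases "fst v = 0")
  case False
  have r: "filterlim (\<lambda>i. real (r i)) at_top sequentially"
    using assms(2) filterlim_compose filterlim_real_sequentially by blast
  have "(\<lambda>n. (1 / \<sigma>)^n) \<longlonglongrightarrow> 0"
    using sigma by (intro LIMSEQ_realpow_zero) auto
  then have "(\<lambda>i. (1 / \<sigma>)^r i) \<longlonglongrightarrow> 0"
    using assms(2) by (rule filterlim_compose)
  then have "(\<lambda>i. snd v * \<sigma>^m * (1 / \<sigma>)^r i) \<longlonglongrightarrow> 0"
    by (rule tendsto_mult_right_zero)
  then have "(\<lambda>i. ln (norm (fst v, snd v * \<sigma>^m / \<sigma>^r i))) \<longlonglongrightarrow> ln (norm (fst v, 0::real))"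
    using False by (intro tendsto_intros) (auto simp: power_divide)
  then show ?thesis
    using False r by (auto intro: real_tendsto_divide_at_top)
next
  case True
  then have v: "snd v \<noteq> 0" using assms(1) by (simp add: prod_eq_iff)
  have r: "filterlim (\<lambda>i. real (r i)) at_top sequentially"
    using assms(2) filterlim_compose filterlim_real_sequentially by blast
  have "(\<lambda>i. ln (\<bar>snd v\<bar> * \<sigma>^m) / real (r i) - ln \<sigma>) \<longlonglongrightarrow> 0 - ln \<sigma>"
    by (intro tendsto_diff tendsto_const real_tendsto_divide_at_top[OF tendsto_const r])
  moreover have "\<forall>\<^sub>F i in sequentially. ln (\<bar>snd v\<bar> * \<sigma>^m) / real (r i) - ln \<sigma>
      = ln (norm (fst v, snd v * \<sigma>^m / \<sigma>^r i)) / real (r i)"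
    using eventually_compose_filterlim[OF eventually_gt_at_top[of 0] assms(2)]
  proof eventually_elim
    case (elim i)
    have "ln (norm (fst v, snd v * \<sigma>^m / \<sigma>^r i)) = ln (\<bar>snd v\<bar> * \<sigma>^m) - real (r i) * ln \<sigma>"
      using True v sigma by (simp add: norm_Pair abs_mult ln_div ln_realpow)
    then show ?case using elim by (simp add: field_simps)
  qed
  ultimately show ?thesis
    using True Lim_transform_eventually by fastforce
qed

text \<open>Factor \<open>u (t i) / q i\<close> as \<open>u (t i) / t i\<close> times
  \<open>t i / q i\<close>. Each sequence of times thus yields a linear equation for the supposed
  exponent \<open>L\<close>.\<close>

lemma exponent_along_subsequence:
  fixes u :: "nat \<Rightarrow> real"
  assumes "(\<lambda>n. 1 / real n * u n) \<longlonglongrightarrow> L" and "filterlim t at_top sequentially"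
    and "(\<lambda>i. real (t i) / q i) \<longlonglongrightarrow> d" and "(\<lambda>i. u (t i) / q i) \<longlonglongrightarrow> c"
  shows "c = L * d"
proof (rule LIMSEQ_unique[OF assms(4)])
  have "(\<lambda>i. 1 / real (t i) * u (t i) * (real (t i) / q i)) \<longlonglongrightarrow> L * d"
    by (intro tendsto_mult assms(3) filterlim_compose[OF assms(1,2)])
  moreover have "\<forall>\<^sub>F i in sequentially. 1 / real (t i) * u (t i) * (real (t i) / q i) = u (t i) / q i"
    using eventually_compose_filterlim[OF eventually_gt_at_top[of 0] assms(2)] by eventually_elim simp
  ultimately show "(\<lambda>i. u (t i) / q i) \<longlonglongrightarrow> L * d"
    by (rule Lim_transform_eventually)
qed

lemma return_time_ratio:
  assumes "0 < m"
  shows "(\<lambda>i. real (return_time m (Suc i)) / real (m * 4^i)) \<longlonglongrightarrow> 4"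
proof -
  \<comment> \<open>The leading 4 arises from dividing the time after \<open>Suc i\<close> pairs by
    \<open>m * 4^i\<close>; the delay due to \<open>k\<^sub>0\<close> is linear in \<open>i\<close>
    and disappears in the limit.\<close>
  have "(\<lambda>i. 4 - (1/4)^i + (2 * real k\<^sub>0 / real m) * (real i * (1/4)^i + (1/4)^i))
      \<longlonglongrightarrow> 4 - 0 + (2 * real k\<^sub>0 / real m) * (0 + 0)"
    by (intro tendsto_intros LIMSEQ_realpow_zero powser_times_n_limit_0) auto
  moreover have "4 - (1/4)^i + (2 * real k\<^sub>0 / real m) * (real i * (1/4)^i + (1/4)^i)
      = real (return_time m (Suc i)) / real (m * 4^i)" for i
    using assms by (simp add: return_time_eq field_simps power_divide)
  ultimately show ?thesis by simp
qed

lemma filterlim_return_time: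
  assumes "0 < m"
  shows "filterlim (\<lambda>i. return_time m (Suc i)) at_top sequentially"
proof (rule filterlim_at_top_mono[OF filterlim_ident always_eventually], rule allI)
  fix i
  have "i = (\<Sum>j<i. 1::nat)" by simp
  also have "\<dots> \<le> return_time m i"
    unfolding return_time_def using assms by (intro sum_mono) (simp add: Suc_le_eq)
  also have "\<dots> \<le> return_time m (Suc i)" by (simp add: return_time_def)
  finally show "i \<le> return_time m (Suc i)" .
qed

lemma irregular_S:
  assumes m: "n\<^sub>0 < m" and z: "z \<in> S \<sigma> a b m" and v: "v \<noteq> 0"
  shows "lyapunov_irregular f z v"
proof (rule ccontr)
  let ?u = "\<lambda>n. ln (norm (D n z v))"
  let ?q = "\<lambda>i. m * 4^i"
  let ?G = "\<lambda>r. ln (norm (fst v, snd v * \<sigma>^m / \<sigma>^r))"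
  let ?t = "\<lambda>i. return_time m (Suc i)"
  define c where "c = (if fst v = 0 then - ln \<sigma> else 0)"
  assume "\<not> ?thesis"
  then obtain L where L: "(\<lambda>n. 1 / real n * ?u n) \<longlonglongrightarrow> L"
    unfolding lyapunov_irregular_def convergent_def by auto
  have m0: "0 < m" using m by simp
  have q: "filterlim ?q at_top sequentially"
  proof (rule filterlim_at_top_mono[OF filterlim_ident always_eventually], rule allI)
    fix i :: nat
    have "i \<le> 4^i" by (simp add: less_imp_le less_exp)
    also have "\<dots> \<le> ?q i" using m0 by simp
    finally show "i \<le> ?q i" .
  qed
  have G1: "(\<lambda>i. ?G (?q i) / real (?q i)) \<longlonglongrightarrow> c"
    unfolding c_def by (rule ln_norm_growth[OF v q])
  \<comment> \<open>The factor 4 is \<open>?q (Suc i) / ?q i\<close>: both sequences of times are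
    normalised by the same \<open>?q i\<close>.\<close>
  have "(\<lambda>i. 4 * (?G (?q (Suc i)) / real (?q (Suc i)))) \<longlonglongrightarrow> 4 * c"
    using LIMSEQ_Suc[OF G1] by (intro tendsto_intros)
  then have "(\<lambda>i. ?u (?t i) / real (?q i)) \<longlonglongrightarrow> 4 * c"
    by (simp add: norm_D_return_time[OF m z])
  then have 1: "4 * c = L * 4"
    by (rule exponent_along_subsequence[OF L filterlim_return_time[OF m0] return_time_ratio[OF m0]])
  have t: "filterlim (\<lambda>i. ?q i + ?t i) at_top sequentially"
    by (rule filterlim_at_top_mono[OF q]) simp
  have "(\<lambda>i. 1 + real (?t i) / real (?q i)) \<longlonglongrightarrow> 1 + 4"
    by (intro tendsto_add tendsto_const return_time_ratio[OF m0])
  then have d: "(\<lambda>i. real (?q i + ?t i) / real (?q i)) \<longlonglongrightarrow> 5"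
    using m0 by (simp add: add_divide_distrib)
  have pos: "0 < norm (fst v, snd v * \<sigma>^m / \<sigma>^r)" for r
    using v sigma by (auto simp: prod_eq_iff zero_prod_def)
  have "?u (?q i + ?t i) / real (?q i) = ?G (?q i) / real (?q i) - 2 * ln \<sigma>" for i
  proof -
    have "?u (?q i + ?t i) = ?G (?q i) - real (2 * ?q i) * ln \<sigma>"
      unfolding norm_D_after_return_time[OF m z]
      using pos sigma by (subst ln_div) (simp_all add: ln_realpow)
    then show ?thesis using m0 by (simp add: field_simps)
  qed
  moreover have "(\<lambda>i. ?G (?q i) / real (?q i) - 2 * ln \<sigma>) \<longlonglongrightarrow> c - 2 * ln \<sigma>"
    by (intro tendsto_diff tendsto_const G1)
  ultimately have "(\<lambda>i. ?u (?q i + ?t i) / real (?q i)) \<longlonglongrightarrow> c - 2 * ln \<sigma>"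
    by (simp only:)
  then have 2: "c - 2 * ln \<sigma> = L * 5"
    by (rule exponent_along_subsequence[OF L t d])
  have "ln \<sigma> > 0" using sigma by simp
  \<comment> \<open>The two equations give \<open>L = c\<close> and
    \<open>c = - ln \<sigma> / 2\<close>, strictly between the two possible values
    \<open>- ln \<sigma>\<close> and 0 of \<open>c\<close>.\<close>
  then show False
    using 1 2 by (auto simp: c_def split: if_splits)
qed

text \<open>The orbit is restarted after its first return, at level \<open>2 * n\<^sub>0\<close>,
  which exceeds \<open>n\<^sub>0\<close>; the transported vector is still nonzero.\<close>

lemma irregular_S_n0:
  assumes "z \<in> S \<sigma> a b n\<^sub>0" "v \<noteq> 0"
  shows "lyapunov_irregular f z v"
proof (rule lyapunov_irregular_shift[OF differentiable])
  show "lyapunov_irregular f ((f ^^ (k\<^sub>0 + n\<^sub>0)) z) (D (k\<^sub>0 + n\<^sub>0) z v)"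
    using first_return[OF assms(1)] D_nonzero[OF assms(2)] n0_pos
    by (intro irregular_S[of "2 * n\<^sub>0"]) auto
qed

end

theorem theorem1p3:
  fixes \<sigma> a b :: real and n\<^sub>0 k\<^sub>0 :: nat and f :: "real \<times> real \<Rightarrow> real \<times> real"
  assumes "1 < \<sigma>" and "1 < a" and "a < b" and "b < \<sigma>"
    and "GGS_diffeo \<sigma> a b n\<^sub>0 k\<^sub>0 f"
  shows "\<forall>z \<in> S \<sigma> a b n\<^sub>0. \<forall>v. v \<noteq> 0 \<longrightarrow> lyapunov_irregular f z v"
proof -
  interpret ggs \<sigma> a b n\<^sub>0 k\<^sub>0 f
    using assms by unfold_locales
  show ?thesis using irregular_S_n0 by blast
qed

end
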